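(* Let $X$ be a Banach space with the alternative Daugavet property, let $\varepsilon>0$ and let $S$ be a Lip-slice of $S_X$. Then for every $x\in S_X$ there is $y\in S$ such that $\max_{\theta\in\mathbb{T}}\|x+\theta y\|>2-\varepsilon$.
   Context: $X$ is a Banach space over $\mathbb{K}=\mathbb{R}$ or $\mathbb{C}$, $S_X$ its unit sphere, $L(X)$ the bounded linear operators on $X$, and $\mathbb{T}=\{\theta\in\mathbb{K}:|\theta|=1\}$. $X$ has the alternative Daugavet property if every rank-one operator $T\in L(X)$ satisfies $\max_{\theta\in\mathbb{T}}\|\mathrm{Id}+\theta T\|=1+\|T\|$. A Lip-slice of $S_X$ is a non-empty set of the form $$\left\{\frac{x_1-x_2}{\|x_1-x_2\|} : x_1,x_2\in X,\ x_1\neq x_2,\ \frac{f(x_1)-f(x_2)}{\|x_1-x_2\|}>\alpha\right\},$$ where $\alpha\in\mathbb{R}$ and $f:X\to\mathbb{R}$ is a Lipschitz function (not necessarily linear) that is non-zero in $\operatorname{Lip}(X,\mathbb{R})$, i.e. non-constant. *)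

theory Defs
  imports "HOL-Analysis.Analysis"
begin

text \<open>
  A Banach space over \<open>'k\<close> is a type of class \<^class>\<open>banach\<close>, carrying the addition, the
  norm and the underlying real structure, with a scalar multiplication \<open>scal\<close> by elements
  of \<open>'k\<close>. Only \<open>'k = real\<close> and \<open>'k = complex\<close> are intended. Every complex Banach space
  arises in this way, by restricting its scalars to the reals.
\<close>

locale banach_space_over = vector_space scal
  for scal :: "'k::real_normed_field \<Rightarrow> 'a::banach \<Rightarrow> 'a" +
  assumes norm_scale: "norm (scal c x) = norm c * norm x"
    and scale_of_real: "scal (of_real r) x = r *\<^sub>R x"

lemma banach_space_over_scaleR:
  "banach_space_over (scaleR :: real \<Rightarrow> 'a::banach \<Rightarrow> 'a)"
  by unfold_locales (auto simp: algebra_simps)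

lemma banach_space_over_complex_mult:
  "banach_space_over ((*) :: complex \<Rightarrow> complex \<Rightarrow> complex)"
  by unfold_locales (auto simp: algebra_simps norm_mult scaleR_conv_of_real)

definition max_over :: "'b set \<Rightarrow> ('b \<Rightarrow> real) \<Rightarrow> real" where
  "max_over A f = (GREATEST m. m \<in> f ` A)"

text \<open>
  The greatest value exists below, since the unit spheres of the real and complex numbers
  are compact and the functions maximised over them are continuous.
\<close>

lemma max_over_eqI:
  assumes "a \<in> A" "\<And>b. b \<in> A \<Longrightarrow> f b \<le> f a"
  shows "max_over A f = f a"
  unfolding max_over_def by (rule Greatest_equality) (use assms in auto)

lemma max_over_attained:
  assumes "compact A" "A \<noteq> {}" "continuous_on A f"
  obtains a where "a \<in> A" "max_over A f = f a" "\<And>b. b \<in> A \<Longrightarrow> f b \<le> f a"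
  using continuous_attains_sup[OF assms] max_over_eqI by metis

definition rank_one_operator ::
    "('k::real_normed_field \<Rightarrow> 'a::banach \<Rightarrow> 'a) \<Rightarrow> ('a \<Rightarrow> 'a) \<Rightarrow> bool" where
  "rank_one_operator scal T \<longleftrightarrow>
     bounded_linear T \<and> Vector_Spaces.linear scal scal T \<and>
     vector_space.dim scal (range T) = 1"

definition alternative_daugavet ::
    "('k::real_normed_field \<Rightarrow> 'a::banach \<Rightarrow> 'a) \<Rightarrow> bool" where
  "alternative_daugavet scal \<longleftrightarrow>
     (\<forall>T. rank_one_operator scal T \<longrightarrow>
        max_over (sphere 0 1) (\<lambda>\<theta>. onorm (\<lambda>x. x + scal \<theta> (T x))) = 1 + onorm T)"

definition lip_slice_set :: "('a::banach \<Rightarrow> real) \<Rightarrow> real \<Rightarrow> 'a set" where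
  "lip_slice_set f \<alpha> =
     {(x1 - x2) /\<^sub>R norm (x1 - x2) | x1 x2.
        x1 \<noteq> x2 \<and> (f x1 - f x2) / norm (x1 - x2) > \<alpha>}"

text \<open>
  The elements of \<open>Lip(X, \<real>)\<close> are Lipschitz functions modulo constants, so being non-zero
  there means being non-constant.
\<close>

definition lip_slice :: "'a::banach set \<Rightarrow> bool" where
  "lip_slice S \<longleftrightarrow> S \<noteq> {} \<and>
     (\<exists>f \<alpha>. (\<exists>C. C-lipschitz_on UNIV f) \<and> \<not> f constant_on UNIV \<and> S = lip_slice_set f \<alpha>)"

end

theory Submission
  imports Defs
begin

text \<open>
  Every Lip-slice contains a linear slice through each of its points. Indeed,
  \<open>q v = sup {(f (z + t v) - f z) / t | t > 0, z}\<close> is a sublinear functional bounded by a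
  multiple of the norm. If \<open>u\<close> is in the Lip-slice given by \<open>f\<close> and \<open>\<alpha>\<close>, then \<open>q u > \<alpha>\<close>,
  and by Hahn-Banach there is a linear \<open>g \<le> q\<close> with \<open>g u = q u\<close>. A unit vector \<open>y\<close> with
  \<open>g y > \<alpha>\<close> has \<open>q y > \<alpha>\<close>, so it is the direction of a segment on which \<open>f\<close> has slope greater
  than \<open>\<alpha>\<close>.

  For linear slices the claim follows by evaluating \<open>Id + \<theta> T\<close>, where \<open>T\<close> is the rank-one
  operator \<open>v \<mapsto> G v x\<close>, at a unit vector at which its norm is almost attained.
\<close>

section \<open>The Hahn-Banach theorem for sublinear functionals\<close>

text \<open>Homogeneity is demanded only as an inequality for \<open>t > 0\<close>, which is all
  that has to be checked for infima and suprema of functionals. Equality for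
  \<open>t \<ge> 0\<close> is recovered in \<open>sublinear_scaleR\<close>.\<close>

definition sublinear :: "('a::real_vector \<Rightarrow> real) \<Rightarrow> bool" where
  "sublinear p \<longleftrightarrow>
     (\<forall>v w. p (v + w) \<le> p v + p w) \<and> (\<forall>t>0. \<forall>v. p (t *\<^sub>R v) \<le> t * p v)"

lemma sublinear_add: "sublinear p \<Longrightarrow> p (v + w) \<le> p v + p w"
  by (simp add: sublinear_def)

lemma sublinear_0:
  assumes "sublinear p" shows "p 0 = 0"
proof -
  have "p (0 + 0) \<le> p 0 + p 0" using assms by (rule sublinear_add)
  moreover have "p ((1/2) *\<^sub>R 0) \<le> (1/2) * p 0"
    using assms unfolding sublinear_def by (metis half_gt_zero_iff zero_less_one)
  ultimately show ?thesis by simp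
qed

lemma sublinear_scaleR:
  assumes "sublinear p" "0 \<le> t" shows "p (t *\<^sub>R v) = t * p v"
proof (cases "t = 0")
  case True
  then show ?thesis using assms by (simp add: sublinear_0)
next
  case False
  then have t: "t > 0" using assms by simp
  \<comment> \<open>The reverse inequality comes from scaling \<open>t *\<^sub>R v\<close> back by
    \<open>inverse t\<close>.\<close>
  have "p (inverse t *\<^sub>R (t *\<^sub>R v)) \<le> inverse t * p (t *\<^sub>R v)"
    using assms t unfolding sublinear_def by (meson positive_imp_inverse_positive)
  then have "t * p v \<le> p (t *\<^sub>R v)" using t by (simp add: field_simps)
  moreover have "p (t *\<^sub>R v) \<le> t * p v" using assms t unfolding sublinear_def by blast
  ultimately show ?thesis by simp
qed

lemma sublinear_uminus:
  assumes "sublinear p" shows "- p (- v) \<le> p v"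
  using sublinear_add[OF assms, of v "- v"] sublinear_0[OF assms] by simp

text \<open>The two infima on the right are approached along independent indices \<open>i\<close>
  and \<open>j\<close>, so it suffices that each such pair is matched by one index \<open>k\<close>
  on the left.\<close>

lemma sublinear_INF:
  fixes P :: "'i \<Rightarrow> 'a::real_vector \<Rightarrow> real"
  assumes "I \<noteq> {}"
    and bdd: "\<And>v. bdd_below ((\<lambda>i. P i v) ` I)"
    and add: "\<And>i j v w. i \<in> I \<Longrightarrow> j \<in> I \<Longrightarrow> \<exists>k\<in>I. P k (v + w) \<le> P i v + P j w"
    and scale: "\<And>i t v. i \<in> I \<Longrightarrow> t > 0 \<Longrightarrow> \<exists>k\<in>I. P k (t *\<^sub>R v) \<le> t * P i v"
  shows "sublinear (\<lambda>v. INF i\<in>I. P i v)"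
  unfolding sublinear_def
proof (intro conjI allI impI)
  let ?h = "\<lambda>v. INF i\<in>I. P i v"
  fix v w
  have le: "?h (v + w) - P j w \<le> P i v" if "i \<in> I" "j \<in> I" for i j
    using add[OF that, of v w] cINF_lower[OF bdd, of _ "v + w"] by fastforce
  have "?h (v + w) - P j w \<le> ?h v" if "j \<in> I" for j
    using le that \<open>I \<noteq> {}\<close> by (intro cINF_greatest) auto
  then have "?h (v + w) - ?h v \<le> ?h w"
    using \<open>I \<noteq> {}\<close> by (intro cINF_greatest) (auto simp: algebra_simps)
  then show "?h (v + w) \<le> ?h v + ?h w" by simp
next
  let ?h = "\<lambda>v. INF i\<in>I. P i v"
  fix t :: real and v assume t: "t > 0"
  have "?h (t *\<^sub>R v) / t \<le> P i v" if i: "i \<in> I" for i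
  proof -
    obtain k where "k \<in> I" "P k (t *\<^sub>R v) \<le> t * P i v" using scale[OF i t] by blast
    then have "?h (t *\<^sub>R v) \<le> t * P i v"
      using cINF_lower[OF bdd, of k "t *\<^sub>R v"] by linarith
    then show ?thesis using t by (simp add: field_simps)
  qed
  then have "?h (t *\<^sub>R v) / t \<le> ?h v"
    using \<open>I \<noteq> {}\<close> by (intro cINF_greatest) auto
  then show "?h (t *\<^sub>R v) \<le> t * ?h v" using t by (simp add: field_simps)
qed

text \<open>The witness is the infimum over \<open>t \<ge> 0\<close> of
  \<open>p (v + t *\<^sub>R w) - t * p w\<close>; \<open>t = 0\<close> gives
  \<open>p' \<le> p\<close> and \<open>t = 1\<close> the last bound. It serves twice: to show that
  minimal functionals are additive, and to make a linear functional touch \<open>q\<close> at a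
  given vector.\<close>

lemma sublinear_shift:
  assumes p: "sublinear p"
  obtains p' where "sublinear p'" "p' \<le> p" "\<And>v. p' v \<le> p (v + w) - p w"
proof
  define P where "P t v = p (v + t *\<^sub>R w) - t * p w" for t v
  let ?p' = "\<lambda>v. INF t\<in>{0..}. P t v"
  \<comment> \<open>Subadditivity for \<open>t *\<^sub>R w = (v + t *\<^sub>R w) + (- v)\<close>
    keeps the infimum finite.\<close>
  have lower: "- p (- v) \<le> P t v" if "t \<ge> 0" for t v
    using sublinear_add[OF p, of "v + t *\<^sub>R w" "- v"] sublinear_scaleR[OF p that, of w]
    unfolding P_def by (simp add: algebra_simps)
  have bdd: "bdd_below ((\<lambda>t. P t v) ` {0..})" for v
    using lower by (auto intro!: bdd_belowI2[of _ "- p (- v)"])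
  show "sublinear ?p'"
  proof (rule sublinear_INF)
    fix s t :: real and v w' assume "s \<in> {0..}" "t \<in> {0..}"
    moreover have "P (s + t) (v + w') \<le> P s v + P t w'"
      using sublinear_add[OF p, of "v + s *\<^sub>R w" "w' + t *\<^sub>R w"]
      unfolding P_def by (simp add: algebra_simps)
    ultimately show "\<exists>k\<in>{0..}. P k (v + w') \<le> P s v + P t w'"
      by (intro bexI[of _ "s + t"]) auto
  next
    fix s t :: real and v assume "s \<in> {0..}" "t > 0"
    moreover have "P (t * s) (t *\<^sub>R v) \<le> t * P s v"
      using sublinear_scaleR[OF p, of t "v + s *\<^sub>R w"] \<open>t > 0\<close>
      unfolding P_def by (simp add: algebra_simps)
    ultimately show "\<exists>k\<in>{0..}. P k (t *\<^sub>R v) \<le> t * P s v"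
      by (intro bexI[of _ "t * s"]) auto
  qed (use bdd in auto)
  show "?p' \<le> p"
    using cINF_lower[OF bdd, of 0] by (auto simp: le_fun_def P_def)
  show "?p' v \<le> p (v + w) - p w" for v
    using cINF_lower[OF bdd, of 1] by (auto simp: P_def)
qed

text \<open>By minimality the functional from \<open>sublinear_shift\<close> is \<open>p\<close>
  itself, so its last bound becomes superadditivity of \<open>p\<close>.\<close>

lemma minimal_sublinear_linear:
  assumes p: "sublinear p" and min: "\<And>p'. sublinear p' \<Longrightarrow> p' \<le> p \<Longrightarrow> p' = p"
  shows "linear p"
proof (rule linearI)
  show add: "p (v + w) = p v + p w" for v w
  proof (rule antisym)
    obtain p' where "sublinear p'" "p' \<le> p" "\<And>v. p' v \<le> p (v + w) - p w"
      using sublinear_shift[OF p] by blast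
    then have "p v \<le> p (v + w) - p w" using min by blast
    then show "p v + p w \<le> p (v + w)" by simp
  qed (rule sublinear_add[OF p])
  have neg: "p (- v) = - p v" for v
    using add[of v "- v"] sublinear_0[OF p] by simp
  show "p (t *\<^sub>R v) = t *\<^sub>R p v" for t v
  proof (cases "t \<ge> 0")
    case True
    then show ?thesis using sublinear_scaleR[OF p] by simp
  next
    case False
    then show ?thesis using sublinear_scaleR[OF p, of "- t" v] neg[of "t *\<^sub>R v"] by simp
  qed
qed

text \<open>The pointwise infimum works: it is finite because \<open>- q (- v)\<close> bounds every
  member from below, and subadditivity holds because the smaller of two members handles
  both.\<close>

lemma sublinear_chain_Inf:
  fixes C :: "('a::real_vector \<Rightarrow> real) set"
  assumes sub: "\<And>p. p \<in> C \<Longrightarrow> sublinear p \<and> p \<le> q" and "C \<noteq> {}"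
    and chain: "\<And>p p'. p \<in> C \<Longrightarrow> p' \<in> C \<Longrightarrow> p \<le> p' \<or> p' \<le> p"
  obtains h where "sublinear h" "\<And>p. p \<in> C \<Longrightarrow> h \<le> p"
proof
  let ?h = "\<lambda>v. INF p\<in>C. p v"
  have "- q (- v) \<le> p v" if "p \<in> C" for p v
    using sublinear_uminus[of p v] sub[OF that] le_funD[of p q "- v"] by auto
  then have bdd: "bdd_below ((\<lambda>p. p v) ` C)" for v
    by (auto intro!: bdd_belowI2[of _ "- q (- v)"])
  show "sublinear ?h"
  proof (rule sublinear_INF[OF \<open>C \<noteq> {}\<close> bdd])
    fix p p' v w assume C: "p \<in> C" "p' \<in> C"
    have *: "p (v + w) \<le> p v + p w" "p' (v + w) \<le> p' v + p' w"
      using sub C by (auto intro: sublinear_add)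
    from chain[OF C] show "\<exists>k\<in>C. k (v + w) \<le> p v + p' w"
    proof
      assume "p \<le> p'"
      then show ?thesis using * C by (intro bexI[of _ p]) (auto dest: le_funD[of _ _ w])
    next
      assume "p' \<le> p"
      then show ?thesis using * C by (intro bexI[of _ p']) (auto dest: le_funD[of _ _ v])
    qed
  next
    fix p v and t :: real assume "p \<in> C" "t > 0"
    then show "\<exists>k\<in>C. k (t *\<^sub>R v) \<le> t * p v"
      using sub by (intro bexI[of _ p]) (auto simp: sublinear_def)
  qed
  show "?h \<le> p" if "p \<in> C" for p
    using cINF_lower[OF bdd that] by (auto simp: le_fun_def)
qed

text \<open>Zorn's lemma for the reversed order gives a minimal sublinear functional below
  \<open>q\<close>, and minimal ones are linear.\<close>

lemma sublinear_dominates_linear: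
  fixes q :: "'a::real_vector \<Rightarrow> real"
  assumes q: "sublinear q"
  obtains g where "linear g" "g \<le> q"
proof -
  define A where "A = {p. sublinear p \<and> p \<le> q}"
  have "\<exists>m\<in>A. \<forall>p\<in>A. m \<ge> p \<longrightarrow> p = m"
  proof (rule predicate_Zorn)
    show "partial_order_on A (relation_of (\<ge>) A)"
      by (rule partial_order_on_relation_ofI) auto
  next
    fix C assume C: "C \<in> Chains (relation_of (\<ge>) A)"
    show "\<exists>u\<in>A. \<forall>p\<in>C. p \<ge> u"
    proof (cases "C = {}")
      case True
      then show ?thesis using q by (auto simp: A_def)
    next
      case False
      have CA: "p \<in> C \<Longrightarrow> p \<in> A" for p
        using C by (auto simp: Chains_def relation_of_def)
      obtain h where h: "sublinear h" "\<And>p. p \<in> C \<Longrightarrow> h \<le> p"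
      proof (rule sublinear_chain_Inf[OF _ False])
        show "p \<le> p' \<or> p' \<le> p" if "p \<in> C" "p' \<in> C" for p p'
          using C that by (auto simp: Chains_def relation_of_def)
      qed (use CA in \<open>auto simp: A_def\<close>)
      moreover have "h \<le> q"
        using h(2) CA False unfolding A_def by (blast intro: order_trans)
      ultimately show ?thesis by (auto simp: A_def)
    qed
  qed
  then obtain m where "m \<in> A" "\<And>p. p \<in> A \<Longrightarrow> p \<le> m \<Longrightarrow> p = m" by blast
  then have "linear m"
    by (intro minimal_sublinear_linear) (auto simp: A_def intro: order_trans)
  then show thesis using that \<open>m \<in> A\<close> by (auto simp: A_def)
qed

text \<open>Instead of extending from the line through \<open>u\<close>, shift \<open>q\<close> by
  \<open>u\<close>: this gives \<open>p \<le> q\<close> with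
  \<open>p (- u) \<le> q 0 - q u = - q u\<close>, which forces \<open>g u \<ge> q u\<close> for
  every linear \<open>g \<le> p\<close>.\<close>

theorem sublinear_hahn_banach:
  fixes q :: "'a::real_vector \<Rightarrow> real"
  assumes q: "sublinear q"
  obtains g where "linear g" "g \<le> q" "g u = q u"
proof -
  obtain p where p: "sublinear p" "p \<le> q" "\<And>v. p v \<le> q (v + u) - q u"
    using sublinear_shift[OF q] by blast
  obtain g where g: "linear g" "g \<le> p" using sublinear_dominates_linear[OF p(1)] by blast
  have "g (- u) \<le> - q u"
    using le_funD[OF g(2), of "- u"] p(3)[of "- u"] sublinear_0[OF q] by simp
  then have "q u \<le> g u" using linear_neg[OF g(1)] by simp
  moreover have "g \<le> q" using g p by (blast intro: order_trans)
  ultimately show thesis using that g(1) le_funD[of g q u] by (auto intro: antisym)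
qed

section \<open>Linear slices in Lip-slices\<close>

text \<open>A difference quotient along \<open>v + w\<close> splits at the intermediate point
  \<open>z + t *\<^sub>R v\<close>, and one along \<open>s *\<^sub>R v\<close> with step
  \<open>t\<close> is \<open>s\<close> times one along \<open>v\<close> with step
  \<open>t * s\<close>. The last clause later turns \<open>q y > \<alpha>\<close> into an actual
  pair of points.\<close>

lemma lipschitz_slope_sublinear:
  fixes f :: "'a::real_normed_vector \<Rightarrow> real"
  assumes f: "L-lipschitz_on UNIV f"
  obtains q where "sublinear q" "\<And>v. q v \<le> L * norm v"
    "\<And>z v t. t > 0 \<Longrightarrow> (f (z + t *\<^sub>R v) - f z) / t \<le> q v"
    "\<And>v a. a < q v \<Longrightarrow> \<exists>z. \<exists>t>0. (f (z + t *\<^sub>R v) - f z) / t > a"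
proof
  define F where "F v = (\<lambda>(t, z). (f (z + t *\<^sub>R v) - f z) / t)" for v
  let ?I = "{0<..} \<times> UNIV :: (real \<times> 'a) set"
  let ?q = "\<lambda>v. SUP i\<in>?I. F v i"
  have ne: "?I \<noteq> {}" using gt_ex[of "0::real"] by auto
  have bound: "F v i \<le> L * norm v" if iI: "i \<in> ?I" for v i
  proof -
    obtain t z where i: "i = (t, z)" "t > 0" using iI by auto
    have "f (z + t *\<^sub>R v) - f z \<le> L * norm (t *\<^sub>R v)"
      using lipschitz_onD[OF f, of "z + t *\<^sub>R v" z] by (simp add: dist_norm)
    then show ?thesis using i by (simp add: F_def field_simps)
  qed
  have bdd: "bdd_above (F v ` ?I)" for v
    using bound by (auto intro!: bdd_aboveI2)
  show upper: "(f (z + t *\<^sub>R v) - f z) / t \<le> ?q v" if "t > 0" for z v t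
    using cSUP_upper[OF _ bdd, of "(t, z)" v] that by (simp add: F_def)
  show "?q v \<le> L * norm v" for v
    using bound by (intro cSUP_least ne)
  show "\<exists>z. \<exists>t>0. (f (z + t *\<^sub>R v) - f z) / t > a" if a: "a < ?q v" for v a
    using a less_cSUP_iff[OF ne bdd] by (auto simp: F_def)
  show "sublinear ?q"
    unfolding sublinear_def
  proof (intro conjI allI impI)
    fix v w
    have "F (v + w) i \<le> ?q v + ?q w" if iI: "i \<in> ?I" for i
    proof -
      obtain t z where i: "i = (t, z)" "t > 0" using iI by auto
      have "F (v + w) i = (f (z + t *\<^sub>R v) - f z) / t
          + (f ((z + t *\<^sub>R v) + t *\<^sub>R w) - f (z + t *\<^sub>R v)) / t"
        using i by (simp add: F_def algebra_simps add_divide_distrib diff_divide_distrib)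
      also have "\<dots> \<le> ?q v + ?q w" using i by (intro add_mono upper)
      finally show ?thesis .
    qed
    then show "?q (v + w) \<le> ?q v + ?q w" by (intro cSUP_least ne)
  next
    fix s :: real and v assume s: "s > 0"
    have "F (s *\<^sub>R v) i \<le> s * ?q v" if iI: "i \<in> ?I" for i
    proof -
      obtain t z where i: "i = (t, z)" "t > 0" using iI by auto
      have "F (s *\<^sub>R v) i = s * ((f (z + (t * s) *\<^sub>R v) - f z) / (t * s))"
        using i s by (simp add: F_def)
      also have "\<dots> \<le> s * ?q v" using i s by (intro mult_left_mono upper) auto
      finally show ?thesis .
    qed
    then show "?q (s *\<^sub>R v) \<le> s * ?q v" by (intro cSUP_least ne)
  qed
qed

lemma linear_slice_in_lip_slice:
  fixes f :: "'a::banach \<Rightarrow> real"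
  assumes f: "L-lipschitz_on UNIV f" and u: "u \<in> lip_slice_set f \<alpha>"
  obtains g where "bounded_linear g" "g u > \<alpha>"
    "\<And>y. norm y = 1 \<Longrightarrow> g y > \<alpha> \<Longrightarrow> y \<in> lip_slice_set f \<alpha>"
proof -
  obtain q where q: "sublinear q" "\<And>v. q v \<le> L * norm v"
    "\<And>z v t. t > 0 \<Longrightarrow> (f (z + t *\<^sub>R v) - f z) / t \<le> q v"
    "\<And>v a. a < q v \<Longrightarrow> \<exists>z. \<exists>t>0. (f (z + t *\<^sub>R v) - f z) / t > a"
    using lipschitz_slope_sublinear[OF f] by blast
  obtain g where g: "linear g" "g \<le> q" "g u = q u"
    using sublinear_hahn_banach[OF q(1)] by blast
  have le: "g v \<le> L * norm v" for v
    using le_funD[OF g(2), of v] q(2)[of v] by simp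
  have "\<bar>g v\<bar> \<le> L * norm v" for v
    using le[of v] le[of "- v"] linear_neg[OF g(1), of v] by simp
  then have "bounded_linear g"
    using g(1) by (intro bounded_linear_intro[of g L])
      (auto simp: linear_add linear_scale mult.commute)
  moreover obtain x1 x2 where x: "u = (x1 - x2) /\<^sub>R norm (x1 - x2)" "x1 \<noteq> x2"
    "(f x1 - f x2) / norm (x1 - x2) > \<alpha>"
    using u by (auto simp: lip_slice_set_def)
  \<comment> \<open>Starting at \<open>x2\<close> in direction \<open>u\<close> with step
    \<open>norm (x1 - x2)\<close> one arrives at \<open>x1\<close>, so the quotient is the given
    slope.\<close>
  then have "q u > \<alpha>"
    using q(3)[of "norm (x1 - x2)" x2 u] by simp
  moreover have "y \<in> lip_slice_set f \<alpha>" if y: "norm y = 1" "g y > \<alpha>" for y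
  proof -
    have "q y > \<alpha>" using y le_funD[OF g(2), of y] by simp
    then obtain z t where t: "t > 0" "(f (z + t *\<^sub>R y) - f z) / t > \<alpha>" using q(4) by blast
    \<comment> \<open>Since \<open>norm y = 1\<close>, the segment from \<open>z\<close> to
      \<open>z + t *\<^sub>R y\<close> has length \<open>t\<close> and direction
      \<open>y\<close>.\<close>
    then show ?thesis unfolding lip_slice_set_def
      using y by (intro CollectI exI[of _ "z + t *\<^sub>R y"] exI[of _ z]) auto
  qed
  ultimately show thesis using that g(3) by auto
qed

section \<open>Linear slices and the alternative Daugavet property\<close>

text \<open>Otherwise \<open>b\<close> would be an upper bound for the operator norm. The vector
  found is non-zero and can be normalised.\<close>

lemma onorm_gt_witness:
  assumes T: "bounded_linear T" and b: "0 \<le> b" "b < onorm T"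
  obtains v where "norm v = 1" "b < norm (T v)"
proof -
  obtain v where v: "\<not> norm (T v) \<le> b * norm v"
    using onorm_bound[of b T] b by force
  interpret bounded_linear T by fact
  have "v \<noteq> 0" using v by (auto simp: zero)
  then show thesis
    using v that[of "v /\<^sub>R norm v"] by (simp add: scale field_simps)
qed

lemma (in banach_space_over) bounded_linear_scal: "bounded_linear (scal c)"
proof (rule bounded_linear_intro)
  fix r x
  have "scal c (scal (of_real r) x) = scal (of_real r) (scal c x)"
    by (simp add: mult.commute)
  then show "scal c (r *\<^sub>R x) = r *\<^sub>R scal c x" by (simp only: scale_of_real)
  show "norm (scal c x) \<le> norm x * norm c" by (simp add: norm_scale mult.commute)
qed (rule scale_right_distrib)

lemma (in banach_space_over) rank_one_operator_functional:
  assumes add: "\<And>v w. G (v + w) = G v + G w" and hom: "\<And>c v. G (scal c v) = c * G v"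
    and bound: "\<And>v. norm (G v) \<le> K * norm v" and u: "G u \<noteq> 0" and x: "x \<noteq> 0"
  shows "rank_one_operator scal (\<lambda>v. scal (G v) x)"
  unfolding rank_one_operator_def
proof (intro conjI)
  show "bounded_linear (\<lambda>v. scal (G v) x)"
  proof (rule bounded_linear_intro)
    fix r v
    have "scal (G (scal (of_real r) v)) x = scal (of_real r) (scal (G v) x)"
      by (simp add: hom)
    then show "scal (G (r *\<^sub>R v)) x = r *\<^sub>R scal (G v) x" by (simp only: scale_of_real)
    show "norm (scal (G v) x) \<le> norm v * (K * norm x)"
      using mult_right_mono[OF bound, of "norm x" v] by (simp add: norm_scale mult_ac)
  qed (simp add: add scale_left_distrib)
  show "Vector_Spaces.linear scal scal (\<lambda>v. scal (G v) x)"
    by unfold_locales (auto simp: add hom scale_left_distrib)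
  \<comment> \<open>As \<open>G u \<noteq> 0\<close>, the functional \<open>G\<close> takes every
    scalar value, so the range is the whole line through \<open>x\<close>.\<close>
  have "range (\<lambda>v. scal (G v) x) = range (\<lambda>c. scal c x)"
  proof (intro equalityI subsetI)
    fix y assume "y \<in> range (\<lambda>c. scal c x)"
    then obtain c where "y = scal c x" by blast
    then have "y = scal (G (scal (c / G u) u)) x" using u by (simp add: hom)
    then show "y \<in> range (\<lambda>v. scal (G v) x)" by blast
  qed auto
  also have "\<dots> = span {x}" by (simp add: span_singleton)
  finally show "dim (range (\<lambda>v. scal (G v) x)) = 1"
    using x by (simp add: dim_eq_card_independent)
qed

text \<open>A vector almost attaining the norm 2 of \<open>Id + \<theta> T\<close> must have
  \<open>norm (H v)\<close> close to 1. Rotating it by a unimodular scalar makes \<open>H\<close>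
  positive there. The condition \<open>G y = of_real (norm (G y))\<close> is kept so that the real
  functional behind \<open>G\<close> is also large at \<open>y\<close>.\<close>

lemma alternative_daugavet_slice:
  fixes scal :: "'k::{real_normed_field,heine_borel} \<Rightarrow> 'a::banach \<Rightarrow> 'a"
  assumes scal: "banach_space_over scal" and adp: "alternative_daugavet scal"
    and add: "\<And>v w. G (v + w) = G v + G w" and hom: "\<And>c v. G (scal c v) = c * G v"
    and bound: "\<And>v. norm (G v) \<le> K * norm v"
    and u: "norm u = 1" "norm (G u) > \<alpha>" and "\<alpha> \<ge> 0" and x: "norm x = 1" and "\<epsilon> > 0"
  obtains y \<theta> where "norm y = 1" "G y = of_real (norm (G y))" "norm (G y) > \<alpha>"
    "norm \<theta> = 1" "norm (x + scal \<theta> y) > 2 - \<epsilon>"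
proof -
  interpret banach_space_over scal by fact
  have lin: "bounded_linear G"
  proof (rule bounded_linear_intro)
    show "G (r *\<^sub>R v) = r *\<^sub>R G v" for r v
      using hom[of "of_real r" v] by (simp only: scale_of_real scaleR_conv_of_real)
    show "norm (G v) \<le> norm v * K" for v using bound[of v] by (simp add: mult.commute)
  qed (rule add)
  define N where "N = onorm G"
  have N: "N > \<alpha>" using onorm[OF lin, of u] u by (simp add: N_def)
  then have "N > 0" using \<open>\<alpha> \<ge> 0\<close> by simp
  define H where "H v = G v / of_real N" for v
  have normH: "norm (H v) = norm (G v) / N" for v
    using \<open>N > 0\<close> by (simp add: H_def norm_divide)
  have H_le: "norm (H v) \<le> norm v" for v
    using onorm[OF lin, of v] \<open>N > 0\<close> by (simp add: normH N_def field_simps)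
  have H_hom: "H (scal c v) = c * H v" for c v by (simp add: H_def hom)
  define T where "T v = scal (H v) x" for v
  have rank: "rank_one_operator scal T"
    unfolding T_def
  proof (rule rank_one_operator_functional[where u = u and K = 1])
    show "H u \<noteq> 0" using u \<open>\<alpha> \<ge> 0\<close> \<open>N > 0\<close> by (auto simp: H_def)
    show "x \<noteq> 0" using x by auto
  qed (use H_le in \<open>auto simp: H_def hom add add_divide_distrib\<close>)
  then have T: "bounded_linear T" by (simp add: rank_one_operator_def)
  have normT: "norm (T v) = norm (G v) / N" for v
    by (simp add: T_def norm_scale x normH)
  have "onorm T = 1"
  proof (rule antisym)
    show "onorm T \<le> 1"
      using H_le by (intro onorm_bound) (simp_all add: normT normH)
    have "norm (G v) \<le> N * onorm T * norm v" for v
      using onorm[OF T, of v] \<open>N > 0\<close> by (simp add: normT field_simps)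
    \<comment> \<open>\<open>N\<close> is the least bound for \<open>G\<close>, so it lies below the
      bound just found.\<close>
    then have "N \<le> N * onorm T"
      unfolding N_def using \<open>N > 0\<close> onorm_pos_le[OF T] by (intro onorm_bound) (auto simp: N_def)
    then show "1 \<le> onorm T" using \<open>N > 0\<close> by simp
  qed
  define R where "R \<theta> v = v + scal \<theta> (T v)" for \<theta> v
  have blR: "bounded_linear (R \<theta>)" for \<theta>
    unfolding R_def
    by (intro bounded_linear_add bounded_linear_ident
        bounded_linear_compose[OF bounded_linear_scal T])
  \<comment> \<open>This makes the operator norm continuous in \<open>\<theta>\<close>. By
    compactness the maximum is then attained, which yields one specific
    \<open>\<theta>\<close>.\<close>
  have R_diff: "onorm (R \<theta>) \<le> onorm (R \<theta>') + norm (\<theta> - \<theta>')" for \<theta> \<theta>'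
  proof (rule onorm_bound)
    fix v
    have "R \<theta> v = R \<theta>' v + scal (\<theta> - \<theta>') (T v)"
      by (simp add: R_def scale_left_diff_distrib)
    then have "norm (R \<theta> v) \<le> norm (R \<theta>' v) + norm (\<theta> - \<theta>') * norm (T v)"
      by (metis norm_scale norm_triangle_ineq)
    also have "\<dots> \<le> onorm (R \<theta>') * norm v + norm (\<theta> - \<theta>') * norm v"
      using onorm[OF blR] onorm[OF T] \<open>onorm T = 1\<close>
      by (intro add_mono mult_left_mono) auto
    finally show "norm (R \<theta> v) \<le> (onorm (R \<theta>') + norm (\<theta> - \<theta>')) * norm v"
      by (simp add: algebra_simps)
  qed (simp add: onorm_pos_le[OF blR])
  have "1-lipschitz_on (sphere 0 1) (\<lambda>\<theta>. onorm (R \<theta>))"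
  proof (rule lipschitz_onI)
    show "dist (onorm (R \<theta>)) (onorm (R \<theta>')) \<le> 1 * dist \<theta> \<theta>'" for \<theta> \<theta>'
      using R_diff[of \<theta> \<theta>'] R_diff[of \<theta>' \<theta>]
      by (simp add: dist_norm abs_le_iff norm_minus_commute)
  qed simp
  then have "continuous_on (sphere 0 1) (\<lambda>\<theta>. onorm (R \<theta>))"
    by (rule lipschitz_on_continuous_on)
  moreover have "(1::'k) \<in> sphere 0 1" by simp
  then have "sphere (0::'k) 1 \<noteq> {}" by blast
  ultimately obtain \<theta> where \<theta>: "\<theta> \<in> sphere 0 1"
    "max_over (sphere 0 1) (\<lambda>\<theta>. onorm (R \<theta>)) = onorm (R \<theta>)"
    using max_over_attained[OF compact_sphere] by metis
  have "onorm (R \<theta>) = 2"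
    using adp rank \<theta>(2) \<open>onorm T = 1\<close> unfolding alternative_daugavet_def R_def by force
  \<comment> \<open>The error \<open>\<delta>\<close> is spent twice, in
    \<open>norm (R \<theta> v) > 2 - \<delta>\<close> and in replacing \<open>h *\<^sub>R x\<close>
    by \<open>x\<close>, hence \<open>\<epsilon> / 2\<close>. The other bound ensures
    \<open>h > \<alpha> / N\<close>, that is, \<open>norm (G y) > \<alpha>\<close>.\<close>
  define \<delta> where "\<delta> = min (\<epsilon> / 2) (1 - \<alpha> / N)"
  have "\<alpha> / N \<ge> 0" "\<alpha> / N < 1" using N \<open>N > 0\<close> \<open>\<alpha> \<ge> 0\<close> by auto
  then have \<delta>: "\<delta> > 0" "\<delta> \<le> 1" "\<delta> \<le> \<epsilon> / 2" "\<delta> \<le> 1 - \<alpha> / N"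
    using \<open>\<epsilon> > 0\<close> min.cobounded1[of "\<epsilon> / 2" "1 - \<alpha> / N"] unfolding \<delta>_def by auto
  obtain v where v: "norm v = 1" "2 - \<delta> < norm (R \<theta> v)"
    using onorm_gt_witness[OF blR, of "2 - \<delta>" \<theta>] \<delta> \<open>onorm (R \<theta>) = 2\<close> by auto
  define h where "h = norm (H v)"
  have "norm (R \<theta> v) \<le> norm v + norm (scal \<theta> (T v))"
    unfolding R_def by (rule norm_triangle_ineq)
  then have h: "h > 1 - \<delta>"
    using v \<theta>(1) by (simp add: norm_scale norm_mult T_def x h_def)
  then have "h > 0" using \<delta> by simp
  have "h \<le> 1" using H_le[of v] v by (simp add: h_def)
  \<comment> \<open>This unimodular factor rotates \<open>H v\<close> onto the positive real
    axis.\<close>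
  define c where "c = of_real h / H v"
  have c: "norm c = 1" "c * H v = of_real h"
    using \<open>h > 0\<close> by (auto simp: c_def h_def norm_divide)
  define y where "y = scal c v"
  have Hy: "H y = of_real h" by (simp add: y_def H_hom c)
  have "norm y = 1" by (simp add: y_def norm_scale c v)
  have Gy: "G y = of_real (N * h)"
    using Hy \<open>N > 0\<close> by (simp add: H_def field_simps)
  then have nGy: "norm (G y) = N * h" using \<open>N > 0\<close> \<open>h > 0\<close> by (simp add: norm_mult)
  have "h > \<alpha> / N" using h \<delta> by simp
  then have "N * h > \<alpha>" using \<open>N > 0\<close> by (simp add: field_simps)
  have "\<theta> \<noteq> 0" using \<theta>(1) by auto
  \<comment> \<open>Rotating \<open>R \<theta> v\<close> by \<open>c\<close> preserves its norm and
    gives \<open>y + scal \<theta> (h *\<^sub>R x)\<close>. Factoring out \<open>\<theta>\<close>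
    then leaves \<open>x + scal (inverse \<theta>) y\<close> up to an error of norm
    \<open>1 - h\<close>.\<close>
  have "scal c (scal \<theta> (T v)) = scal \<theta> (scal (c * H v) x)"
    by (simp add: T_def mult_ac)
  then have "scal c (R \<theta> v) = y + scal \<theta> (h *\<^sub>R x)"
    by (simp add: R_def y_def scale_right_distrib c(2) scale_of_real)
  also have "h *\<^sub>R x = x - (1 - h) *\<^sub>R x" by (simp add: algebra_simps)
  also have "y + scal \<theta> (x - (1 - h) *\<^sub>R x)
      = scal \<theta> (x + scal (inverse \<theta>) y) - scal \<theta> ((1 - h) *\<^sub>R x)"
    using \<open>\<theta> \<noteq> 0\<close> by (simp add: scale_right_distrib scale_right_diff_distrib)
  finally have "norm (R \<theta> v) \<le> norm (x + scal (inverse \<theta>) y) + (1 - h)"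
    using norm_triangle_ineq4[of "scal \<theta> (x + scal (inverse \<theta>) y)" "scal \<theta> ((1 - h) *\<^sub>R x)"]
      norm_scale[of c "R \<theta> v"] c \<theta>(1) x \<open>h \<le> 1\<close> by (simp add: norm_scale)
  then have "norm (x + scal (inverse \<theta>) y) > 2 - \<epsilon>" using v h \<delta> by simp
  moreover have "norm (inverse \<theta>) = 1" using \<theta>(1) by (simp add: norm_inverse)
  ultimately show thesis
    using that \<open>norm y = 1\<close> Gy nGy \<open>N * h > \<alpha>\<close> by metis
qed

section \<open>From linear slices to Lip-slices over both scalar fields\<close>

lemma norm_le_max_over:
  fixes scal :: "'k::{real_normed_field,heine_borel} \<Rightarrow> 'a::banach \<Rightarrow> 'a"
  assumes "banach_space_over scal" and "norm \<theta> = 1"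
  shows "norm (x + scal \<theta> y) \<le> max_over (sphere 0 1) (\<lambda>\<theta>. norm (x + scal \<theta> y))"
proof -
  interpret banach_space_over scal by fact
  have "(norm y)-lipschitz_on (sphere 0 1) (\<lambda>\<theta>. scal \<theta> y)"
    by (rule lipschitz_onI)
      (auto simp: dist_norm norm_scale mult.commute scale_left_diff_distrib[symmetric])
  then have "continuous_on (sphere 0 1) (\<lambda>\<theta>. norm (x + scal \<theta> y))"
    by (intro continuous_intros lipschitz_on_continuous_on)
  moreover have "\<theta> \<in> sphere 0 1" using assms by simp
  ultimately show ?thesis
    by (metis (no_types, lifting) max_over_attained[OF compact_sphere] empty_iff)
qed

text \<open>
  The functional \<open>G\<close> is \<open>g\<close> itself in the real case and the complexification of \<open>g\<close> in the
  complex case.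
\<close>

lemma lip_slice_max_over:
  fixes scal :: "'k::{real_normed_field,heine_borel} \<Rightarrow> 'a::banach \<Rightarrow> 'a"
  assumes scal: "banach_space_over scal" and adp: "alternative_daugavet scal"
    and S: "lip_slice S" and x: "x \<in> sphere 0 1" and "\<epsilon> > 0"
    and ext: "\<And>g. bounded_linear g \<Longrightarrow> \<exists>G :: 'a \<Rightarrow> 'k. \<exists>K. (\<forall>v w. G (v + w) = G v + G w) \<and>
      (\<forall>c v. G (scal c v) = c * G v) \<and> (\<forall>v. norm (G v) \<le> K * norm v) \<and>
      (\<forall>v. g v \<le> norm (G v)) \<and> (\<forall>v. G v = of_real (norm (G v)) \<longrightarrow> g v = norm (G v))"
  shows "\<exists>y\<in>S. max_over (sphere 0 1) (\<lambda>\<theta>. norm (x + scal \<theta> y)) > 2 - \<epsilon>"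
proof -
  interpret banach_space_over scal by fact
  obtain f \<alpha> L u where f: "L-lipschitz_on UNIV f" and S_eq: "S = lip_slice_set f \<alpha>" and "u \<in> S"
    using S by (auto simp: lip_slice_def)
  then obtain g where g: "bounded_linear g" "g u > \<alpha>"
    and slice: "\<And>y. norm y = 1 \<Longrightarrow> g y > \<alpha> \<Longrightarrow> y \<in> S"
    using linear_slice_in_lip_slice[OF f] by metis
  interpret g: bounded_linear g by fact
  have nx: "norm x = 1" using x by simp
  have "\<exists>y \<theta>. norm y = 1 \<and> g y > \<alpha> \<and> norm \<theta> = 1 \<and> norm (x + scal \<theta> y) > 2 - \<epsilon>"
  \<comment> \<open>\<open>alternative_daugavet_slice\<close> covers
    \<open>\<alpha> \<ge> 0\<close>. For negative \<open>\<alpha>\<close>, one of \<open>x\<close>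
    and \<open>- x\<close> already lies in the slice.\<close>
  proof (cases "\<alpha> \<ge> 0")
    case True
    obtain G :: "'a \<Rightarrow> 'k" and K where G: "\<And>v w. G (v + w) = G v + G w"
      "\<And>c v. G (scal c v) = c * G v" "\<And>v. norm (G v) \<le> K * norm v"
      "\<And>v. g v \<le> norm (G v)" "\<And>v. G v = of_real (norm (G v)) \<Longrightarrow> g v = norm (G v)"
      using ext[OF g(1)] by blast
    have "norm u = 1" using \<open>u \<in> S\<close> by (auto simp: S_eq lip_slice_set_def)
    moreover have "norm (G u) > \<alpha>" using g(2) G(4)[of u] by simp
    ultimately obtain y \<theta> where "norm y = 1" "G y = of_real (norm (G y))" "norm (G y) > \<alpha>"
      "norm \<theta> = 1" "norm (x + scal \<theta> y) > 2 - \<epsilon>"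
      using alternative_daugavet_slice[OF scal adp G(1,2,3) _ _ True nx \<open>\<epsilon> > 0\<close>] by metis
    then show ?thesis using G(5) by metis
  next
    case False
    \<comment> \<open>The sign gives
      \<open>g (s *\<^sub>R x) = \<bar>g x\<bar> \<ge> 0 > \<alpha>\<close>, and choosing
      \<open>\<theta> = s\<close> turns the sum into \<open>2 *\<^sub>R x\<close>.\<close>
    define s :: real where "s = (if g x \<ge> 0 then 1 else - 1)"
    have "scal (of_real s) (s *\<^sub>R x) = x" by (simp add: s_def scale_of_real)
    then have "norm (x + scal (of_real s) (s *\<^sub>R x)) = 2"
      using nx by (simp add: scaleR_2[symmetric])
    moreover have "g (s *\<^sub>R x) > \<alpha>" using False by (simp add: s_def g.neg)
    moreover have "norm (s *\<^sub>R x) = 1" "norm (of_real s :: 'k) = 1" using nx by (auto simp: s_def)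
    ultimately show ?thesis using \<open>\<epsilon> > 0\<close>
      by (intro exI[of _ "s *\<^sub>R x"] exI[of _ "of_real s"]) auto
  qed
  then show ?thesis
    using slice norm_le_max_over[OF scal] by (meson less_le_trans)
qed

text \<open>Complex linearity forces the imaginary part of \<open>G v\<close> to be
  \<open>- g (scal \<i> v)\<close>. The crude constant \<open>2 * onorm g\<close> is enough, because
  only boundedness of \<open>G\<close> is needed.\<close>

lemma complexified_functional:
  fixes scal :: "complex \<Rightarrow> 'a::banach \<Rightarrow> 'a" and g :: "'a \<Rightarrow> real"
  assumes scal: "banach_space_over scal" and g: "bounded_linear g"
  obtains G K where "\<And>v w. G (v + w) = G v + G w" "\<And>c v. G (scal c v) = c * G v"
    "\<And>v. norm (G v) \<le> K * norm v" "\<And>v. Re (G v) = g v"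
proof
  interpret banach_space_over scal by fact
  interpret g: bounded_linear g by fact
  let ?G = "\<lambda>v. Complex (g v) (- g (scal \<i> v))"
  show "?G (v + w) = ?G v + ?G w" for v w
    by (simp add: complex_eq_iff g.add scale_right_distrib)
  show "?G (scal c v) = c * ?G v" for c v
  proof -
    \<comment> \<open>Splitting \<open>c\<close> into real and imaginary parts reduces complex
      homogeneity to real linearity of \<open>g\<close>.\<close>
    have c: "scal c v = Re c *\<^sub>R v + Im c *\<^sub>R scal \<i> v" for c v
      unfolding scale_of_real[symmetric]
      by (simp add: scale_left_distrib[symmetric] complex_eq[symmetric] mult.commute)
    have "scal \<i> (scal c v) = Re c *\<^sub>R scal \<i> v - Im c *\<^sub>R v"
      using c[of "\<i> * c" v] by simp
    then show ?thesis
      by (simp add: c[of c v] complex_eq_iff g.add g.diff g.scaleR)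
  qed
  show "norm (?G v) \<le> (2 * onorm g) * norm v" for v
  proof -
    have "norm (?G v) \<le> \<bar>g v\<bar> + \<bar>g (scal \<i> v)\<bar>"
      using cmod_le[of "?G v"] by simp
    also have "\<dots> \<le> onorm g * norm v + onorm g * norm (scal \<i> v)"
      using onorm[OF g] by (intro add_mono) (metis real_norm_def)+
    finally show ?thesis by (simp add: norm_scale)
  qed
qed simp

theorem corollary2p7:
  fixes S :: "'a::banach set" and \<epsilon> :: real
  assumes "\<epsilon> > 0" and "lip_slice S"
  shows
    "(alternative_daugavet (scaleR :: real \<Rightarrow> 'a \<Rightarrow> 'a) \<longrightarrow>
       (\<forall>x\<in>sphere 0 1. \<exists>y\<in>S.
          max_over (sphere 0 1 :: real set) (\<lambda>\<theta>. norm (x + \<theta> *\<^sub>R y)) > 2 - \<epsilon>)) \<and>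
     (\<forall>scal :: complex \<Rightarrow> 'a \<Rightarrow> 'a.
       banach_space_over scal \<longrightarrow> alternative_daugavet scal \<longrightarrow>
       (\<forall>x\<in>sphere 0 1. \<exists>y\<in>S.
          max_over (sphere 0 1 :: complex set) (\<lambda>\<theta>. norm (x + scal \<theta> y)) > 2 - \<epsilon>))"
proof (intro conjI impI allI ballI)
  fix x :: 'a
  assume adp: "alternative_daugavet (scaleR :: real \<Rightarrow> 'a \<Rightarrow> 'a)" and x: "x \<in> sphere 0 1"
  show "\<exists>y\<in>S. max_over (sphere 0 1 :: real set) (\<lambda>\<theta>. norm (x + \<theta> *\<^sub>R y)) > 2 - \<epsilon>"
  proof (rule lip_slice_max_over[OF banach_space_over_scaleR adp assms(2) x assms(1)])
    fix g :: "'a \<Rightarrow> real" assume g: "bounded_linear g"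
    then interpret g: bounded_linear g .
    show "\<exists>G :: 'a \<Rightarrow> real. \<exists>K. (\<forall>v w. G (v + w) = G v + G w) \<and>
      (\<forall>c v. G (c *\<^sub>R v) = c * G v) \<and> (\<forall>v. norm (G v) \<le> K * norm v) \<and>
      (\<forall>v. g v \<le> norm (G v)) \<and> (\<forall>v. G v = of_real (norm (G v)) \<longrightarrow> g v = norm (G v))"
      using onorm[OF g]
      by (intro exI[of _ g] exI[of _ "onorm g"]) (auto simp: g.add g.scaleR)
  qed
next
  fix scal :: "complex \<Rightarrow> 'a \<Rightarrow> 'a" and x :: 'a
  assume scal: "banach_space_over scal" and adp: "alternative_daugavet scal"
    and x: "x \<in> sphere 0 1"
  show "\<exists>y\<in>S. max_over (sphere 0 1 :: complex set) (\<lambda>\<theta>. norm (x + scal \<theta> y)) > 2 - \<epsilon>"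
  proof (rule lip_slice_max_over[OF scal adp assms(2) x assms(1)])
    fix g :: "'a \<Rightarrow> real" assume g: "bounded_linear g"
    obtain G K where G: "\<And>v w. G (v + w) = G v + G w" "\<And>c v. G (scal c v) = c * G v"
      "\<And>v. norm (G v) \<le> K * norm v" "\<And>v. Re (G v) = g v"
      using complexified_functional[OF scal g] by blast
    have "g v \<le> norm (G v)" for v
      using G(4) complex_Re_le_cmod by metis
    moreover have "g v = norm (G v)" if "G v = of_real (norm (G v))" for v
      using G(4) that by (metis Re_complex_of_real)
    ultimately show "\<exists>G :: 'a \<Rightarrow> complex. \<exists>K. (\<forall>v w. G (v + w) = G v + G w) \<and>
      (\<forall>c v. G (scal c v) = c * G v) \<and> (\<forall>v. norm (G v) \<le> K * norm v) \<and>
      (\<forall>v. g v \<le> norm (G v)) \<and> (\<forall>v. G v = of_real (norm (G v)) \<longrightarrow> g v = norm (G v))"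
      using G by blast
  qed
qed

end
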